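(* As formal power series (equivalently, entire functions) in $x$, $$c_1^3e^{\alpha x}+c_2^3e^{\beta x}+c_3^3e^{\gamma x}=\frac{1}{44}\sum_{n=0}^\infty T_n^{(3,3,5)}\frac{x^n}{n!}.$$
   Context: Let $\alpha,\beta,\gamma$ be the three distinct complex roots of $x^3-x^2-x-1=0$, and set $c_1=\frac{\alpha}{(\alpha-\beta)(\alpha-\gamma)}$, $c_2=\frac{\beta}{(\beta-\alpha)(\beta-\gamma)}$, $c_3=\frac{\gamma}{(\gamma-\alpha)(\gamma-\beta)}$. For numbers $s_0,s_1,s_2$, the sequence $T_n^{(s_0,s_1,s_2)}$ is defined by $T_0^{(s_0,s_1,s_2)}=s_0$, $T_1^{(s_0,s_1,s_2)}=s_1$, $T_2^{(s_0,s_1,s_2)}=s_2$ and $T_n^{(s_0,s_1,s_2)}=T_{n-1}^{(s_0,s_1,s_2)}+T_{n-2}^{(s_0,s_1,s_2)}+T_{n-3}^{(s_0,s_1,s_2)}$ for $n\ge3$. *)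

theory Defs
  imports Complex_Main "HOL-Computational_Algebra.Formal_Power_Series"
begin

fun trib :: "'a::ab_semigroup_add \<Rightarrow> 'a \<Rightarrow> 'a \<Rightarrow> nat \<Rightarrow> 'a" where
  "trib s0 s1 s2 0 = s0"
| "trib s0 s1 s2 (Suc 0) = s1"
| "trib s0 s1 s2 (Suc (Suc 0)) = s2"
| "trib s0 s1 s2 (Suc (Suc (Suc n))) =
     trib s0 s1 s2 (Suc (Suc n)) + trib s0 s1 s2 (Suc n) + trib s0 s1 s2 n"

end

theory Submission
  imports Defs
begin

text \<open>
  Each $c_i$ equals $\alpha_i / f'(\alpha_i)$ for $f = x^3 - x^2 - x - 1$ and is a root of
  $44 x^3 - 2 x - 1$. Hence $44 \sum c_i^3 \alpha_i^n = 2 \sum c_i \alpha_i^n + \sum \alpha_i^n$,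
  a Tribonacci sequence with initial values $2 \cdot (0,1,1) + (3,1,3) = (3,3,5)$.
\<close>

text \<open>Subtracting the equations of two roots and cancelling their difference leaves a
  symmetric quadratic relation. Two such relations that share \<open>a\<close> differ by
  \<open>(b - c) * (a + b + c - 1)\<close>.\<close>

lemma tribonacci_vieta:
  fixes a b c :: "'a::field"
  assumes "a^3 - a^2 - a - 1 = 0" "b^3 - b^2 - b - 1 = 0" "c^3 - c^2 - c - 1 = 0"
    and "a \<noteq> b" "a \<noteq> c" "b \<noteq> c"
  shows "a + b + c = 1" "a * b + a * c + b * c = -1"
proof -
  have q: "x^2 + x * y + y^2 - x - y - 1 = 0"
    if "x^3 - x^2 - x - 1 = 0" "y^3 - y^2 - y - 1 = 0" "x \<noteq> y" for x y :: 'a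
  proof -
    have "(x - y) * (x^2 + x * y + y^2 - x - y - 1)
        = (x^3 - x^2 - x - 1) - (y^3 - y^2 - y - 1)"
      by algebra
    with that show ?thesis by simp
  qed
  note ab = q[OF assms(1,2,4)] and ac = q[OF assms(1,3,5)]
  have "(b - c) * (a + b + c - 1) = 0"
    using ab ac by algebra
  with \<open>b \<noteq> c\<close> show s: "a + b + c = 1" by simp
  show "a * b + a * c + b * c = -1"
    using ab s by algebra
qed

text \<open>Both sides are f'(a): on the left from the factored form of f, on the right from its
  coefficients.\<close>

lemma tribonacci_derivative_at_root:
  fixes a b c :: "'a::idom"
  assumes "a + b + c = 1" "a * b + a * c + b * c = -1"
  shows "(a - b) * (a - c) = 3 * a^2 - 2 * a - 1"
  using assms by algebra

text \<open>After multiplication by \<open>d^3\<close> this is a polynomial identity modulo the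
  cubic of \<open>a\<close>. The constant 44 is minus the discriminant of f, which is the product of
  f' over the three roots.\<close>

lemma tribonacci_coeff_cube:
  fixes a d :: "'a::field"
  assumes "a^3 - a^2 - a - 1 = 0" "d = 3 * a^2 - 2 * a - 1" "d \<noteq> 0"
  shows "44 * (a / d)^3 = 2 * (a / d) + 1"
proof -
  have "44 * a^3 = 2 * a * d^2 + d^3"
    using assms(1,2) by algebra
  with \<open>d \<noteq> 0\<close> show ?thesis
    by (simp add: field_simps power2_eq_square power3_eq_cube)
qed

lemma trib_unique:
  assumes "u 0 = s0" "u 1 = s1" "u 2 = s2"
    and "\<And>n. u (n + 3) = u (n + 2) + u (n + 1) + u n"
  shows "trib s0 s1 s2 n = u n"
  using assms by (induction s0 s1 s2 n rule: trib.induct) (simp_all add: eval_nat_numeral)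

theorem lemma7:
  fixes \<alpha> \<beta> \<gamma> c1 c2 c3 :: complex
  assumes roots: "{z::complex. z^3 - z^2 - z - 1 = 0} = {\<alpha>, \<beta>, \<gamma>}"
    and dist: "\<alpha> \<noteq> \<beta>" "\<alpha> \<noteq> \<gamma>" "\<beta> \<noteq> \<gamma>"
    and c1: "c1 = \<alpha> / ((\<alpha> - \<beta>) * (\<alpha> - \<gamma>))"
    and c2: "c2 = \<beta> / ((\<beta> - \<alpha>) * (\<beta> - \<gamma>))"
    and c3: "c3 = \<gamma> / ((\<gamma> - \<alpha>) * (\<gamma> - \<beta>))"
  shows "fps_const (c1^3) * fps_exp \<alpha> + fps_const (c2^3) * fps_exp \<beta> + fps_const (c3^3) * fps_exp \<gamma>
           = fps_const (1/44) * Abs_fps (\<lambda>n. trib 3 3 5 n / fact n)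
       \<and> (\<forall>x::complex. summable (\<lambda>n. trib 3 3 5 n * (x^n / fact n)) \<and>
            c1^3 * exp (\<alpha> * x) + c2^3 * exp (\<beta> * x) + c3^3 * exp (\<gamma> * x)
              = 1/44 * (\<Sum>n. trib 3 3 5 n * (x^n / fact n)))"
proof -
  have "\<alpha> \<in> {z. z^3 - z^2 - z - 1 = 0}" "\<beta> \<in> {z. z^3 - z^2 - z - 1 = 0}"
    "\<gamma> \<in> {z. z^3 - z^2 - z - 1 = 0}"
    unfolding roots by simp_all
  then have r: "\<alpha>^3 - \<alpha>^2 - \<alpha> - 1 = 0" "\<beta>^3 - \<beta>^2 - \<beta> - 1 = 0" "\<gamma>^3 - \<gamma>^2 - \<gamma> - 1 = 0"
    by simp_all
  then have r3: "\<alpha>^3 = \<alpha>^2 + \<alpha> + 1" "\<beta>^3 = \<beta>^2 + \<beta> + 1" "\<gamma>^3 = \<gamma>^2 + \<gamma> + 1"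
    by (simp_all add: diff_eq_eq)
  note v = tribonacci_vieta[OF r dist]
  have nz: "(\<alpha> - \<beta>) * (\<alpha> - \<gamma>) \<noteq> 0" "(\<beta> - \<alpha>) * (\<beta> - \<gamma>) \<noteq> 0" "(\<gamma> - \<alpha>) * (\<gamma> - \<beta>) \<noteq> 0"
    using dist by auto
  have "44 * c1^3 = 2 * c1 + 1"
    unfolding c1 using tribonacci_derivative_at_root[of \<alpha> \<beta> \<gamma>] v
    by (intro tribonacci_coeff_cube r nz) auto
  \<comment> \<open>The Vieta relations are symmetric, so each root may take the first place in the
    derivative formula.\<close>
  moreover have "44 * c2^3 = 2 * c2 + 1"
    unfolding c2 using tribonacci_derivative_at_root[of \<beta> \<alpha> \<gamma>] v
    by (intro tribonacci_coeff_cube r nz) (auto simp: algebra_simps)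
  moreover have "44 * c3^3 = 2 * c3 + 1"
    unfolding c3 using tribonacci_derivative_at_root[of \<gamma> \<alpha> \<beta>] v
    by (intro tribonacci_coeff_cube r nz) (auto simp: algebra_simps)
  ultimately have cubes: "44 * c1^3 = 2 * c1 + 1" "44 * c2^3 = 2 * c2 + 1" "44 * c3^3 = 2 * c3 + 1"
    by blast+
  have cd: "c1 * ((\<alpha> - \<beta>) * (\<alpha> - \<gamma>)) = \<alpha>" "c2 * ((\<beta> - \<alpha>) * (\<beta> - \<gamma>)) = \<beta>"
    "c3 * ((\<gamma> - \<alpha>) * (\<gamma> - \<beta>)) = \<gamma>"
    unfolding c1 c2 c3 using nz by simp_all
  \<comment> \<open>The Vandermonde product is a common denominator: every \<open>D * ci\<close> is
    a polynomial in the roots, which turns the moment identities below into polynomial ones.\<close>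
  define D where "D = (\<alpha> - \<beta>) * (\<alpha> - \<gamma>) * (\<beta> - \<gamma>)"
  have D: "D \<noteq> 0" using dist by (simp add: D_def)
  \<comment> \<open>With \<open>D\<close> folded, \<open>\<alpha>\<close> occurs only once in the
    goal, so the substitution hits exactly that factor.\<close>
  have Dc1: "D * c1 = \<alpha> * (\<beta> - \<gamma>)"
    by (subst cd(1)[symmetric]) (simp add: D_def mult_ac)
  have Dc2: "D * c2 = - \<beta> * (\<alpha> - \<gamma>)"
    by (subst cd(2)[symmetric]) (simp add: D_def algebra_simps)
  have Dc3: "D * c3 = \<gamma> * (\<alpha> - \<beta>)"
    by (subst cd(3)[symmetric]) (simp add: D_def algebra_simps)
  note Dc = Dc1 Dc2 Dc3
  \<comment> \<open>The moments of orders 0, 1, 2 are the Lagrange sums of \<alpha>^m / f'(\<alpha>)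
    over the roots for m = 1, 2, 3. Their values are 0, 1 and the sum of the roots, which is
    1.\<close>
  have "D * (c1 + c2 + c3) = 0"
    using Dc by algebra
  then have m0: "c1 + c2 + c3 = 0" using D by simp
  have "D * (c1 * \<alpha> + c2 * \<beta> + c3 * \<gamma> - 1) = 0"
    using Dc D_def by algebra
  then have m1: "c1 * \<alpha> + c2 * \<beta> + c3 * \<gamma> = 1" using D by simp
  have "D * (c1 * \<alpha>^2 + c2 * \<beta>^2 + c3 * \<gamma>^2 - 1) = 0"
    using Dc D_def v(1) by algebra
  then have m2: "c1 * \<alpha>^2 + c2 * \<beta>^2 + c3 * \<gamma>^2 = 1" using D by simp
  \<comment> \<open>Square of the sum minus twice the second symmetric function: 1 + 2.\<close>
  have p2: "\<alpha>^2 + \<beta>^2 + \<gamma>^2 = 3" using v by algebra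
  \<comment> \<open>The factor 44 stands in each summand so that \<open>cubes\<close> can rewrite
    the coefficients to \<open>2 * ci + 1\<close>.\<close>
  define u where "u n = 44 * c1^3 * \<alpha>^n + 44 * c2^3 * \<beta>^n + 44 * c3^3 * \<gamma>^n" for n
  have t: "trib 3 3 5 n = u n" for n
  proof (rule trib_unique)
    show "u 0 = 3" using m0 unfolding u_def cubes by algebra
    show "u 1 = 3" using m1 v(1) unfolding u_def cubes by algebra
    show "u 2 = 5" using m2 p2 unfolding u_def cubes by algebra
    show "u (k + 3) = u (k + 2) + u (k + 1) + u k" for k
      unfolding u_def power_add power_one_right r3 by (simp add: algebra_simps)
  qed
  have "c1^3 * exp (\<alpha> * x) + c2^3 * exp (\<beta> * x) + c3^3 * exp (\<gamma> * x)
      = 1/44 * (\<Sum>n. trib 3 3 5 n * (x^n / fact n)) \<and>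
      summable (\<lambda>n. trib 3 3 5 n * (x^n / fact n))" for x
  proof -
    have e: "(\<lambda>n. (z * x)^n / fact n) sums exp (z * x)" for z
      using exp_converges[of "z * x"] by (simp add: scaleR_conv_of_real field_simps)
    \<comment> \<open>Adding the scaled exponential series with \<open>sums\<close> gives
      summability and the value at once.\<close>
    have "(\<lambda>n. 44 * c1^3 * ((\<alpha> * x)^n / fact n) + 44 * c2^3 * ((\<beta> * x)^n / fact n)
            + 44 * c3^3 * ((\<gamma> * x)^n / fact n))
        sums (44 * c1^3 * exp (\<alpha> * x) + 44 * c2^3 * exp (\<beta> * x) + 44 * c3^3 * exp (\<gamma> * x))"
      by (intro sums_add sums_mult e)
    also have "(\<lambda>n. 44 * c1^3 * ((\<alpha> * x)^n / fact n) + 44 * c2^3 * ((\<beta> * x)^n / fact n)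
            + 44 * c3^3 * ((\<gamma> * x)^n / fact n)) = (\<lambda>n. trib 3 3 5 n * (x^n / fact n))"
      by (simp add: t u_def power_mult_distrib add_divide_distrib distrib_right mult.assoc)
    finally show ?thesis
      by (simp add: sums_iff)
  qed
  moreover have "fps_const (c1^3) * fps_exp \<alpha> + fps_const (c2^3) * fps_exp \<beta>
      + fps_const (c3^3) * fps_exp \<gamma> = fps_const (1/44) * Abs_fps (\<lambda>n. trib 3 3 5 n / fact n)"
    \<comment> \<open>Both sides have the n-th coefficient
      \<open>u n / (44 * fact n)\<close>.\<close>
    by (rule fps_ext) (simp add: t u_def add_divide_distrib)
  ultimately show ?thesis by blast
qed

end
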